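(* Let $G$ be a directed graph on the vertex set $[n+1]$ and let $\mathbf{c}'=(c_1,\ldots,c_n,-\sum_{i=1}^n c_i)\in\mathbb{Z}^{n+1}$ be any net flow vector. Then $$K_G(\mathbf{c}')=\big|\mathcal{GD}_G(\mathbf{c}')\big|,$$ where $K_G$ is the Kostant partition function of $G$ and $\mathcal{GD}_G(\mathbf{c}')$ is the set of gravity diagrams.
   Context: Directed graphs $G$ have vertex set $[n+1]=\{1,\ldots,n+1\}$, may have multiple edges, and every edge $(i,j)$ is directed from a smaller vertex $i$ to a larger vertex $j$. Kostant partition function: $K_G(\mathbf{c}')$ is the number of tuples $(b_e)_{e\in E(G)}$ of nonnegative integers such that $\sum_{e=(i,j)\in E(G)} b_e(\mathbf{e}_i-\mathbf{e}_j)=\mathbf{c}'$ (each copy of a multiple edge has its own $b_e$), where $\mathbf{e}_i$ denotes the standard basis vectors. Gravity diagrams: put $\boldsymbol{\alpha}_i=\mathbf{e}_i-\mathbf{e}_{i+1}$, so $\mathbf{e}_i-\mathbf{e}_j=\boldsymbol{\alpha}_i+\cdots+\boldsymbol{\alpha}_{j-1}$ and $\mathbf{c}'=\sum_{i=1}^n d_i\boldsymbol{\alpha}_i$ with $d_i=c_1+\cdots+c_i$. If some $d_i<0$, there are no diagrams. Otherwise take an array of dots with $n$ columns and $d_i$ dots in column $i$. A line-dot diagram is a partition of the set of all dots into blocks called lines (a single dot being a line of length $0$), together with an assignment of an edge of $G$ to each line, such that a line assigned to an edge $(i,j)$ consists of exactly one dot from each of the columns $i,i+1,\ldots,j-1$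 and no other dots. A line assigned to $(i,j)$ represents the part $[\boldsymbol{\alpha}_i+\cdots+\boldsymbol{\alpha}_{j-1}]$ (if there are several parallel edges $(i,j)$, the parts are distinguished by the edge). Two line-dot diagrams are equivalent if they represent the same vector partition of $\mathbf{c}'$, i.e. for every edge of $G$ they have the same number of lines assigned to it. A gravity diagram is an equivalence class of line-dot diagrams; $\mathcal{GD}_G(\mathbf{c}')$ is the set of them. *)

theory Defs
  imports "Graph_Theory.Digraph" "HOL-Library.FuncSet" "HOL-Library.Disjoint_Sets"
begin

section \<open>Graphs and net flow vectors\<close>

text \<open>Arcs are abstract objects with a tail and a head, so parallel arcs are allowed.\<close>

locale flow_graph = fin_digraph G
  for G :: "(nat, 'e) pre_digraph" (structure) and n :: nat +
  assumes verts_eq: "verts G = {1..n+1}"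
    and tail_less_head: "e \<in> arcs G \<Longrightarrow> tail G e < head G e"

text \<open>Vectors in \<open>\<int>\<^sup>n\<^sup>+\<^sup>1\<close> are functions on \<^typ>\<open>nat\<close> of which only the values on \<open>{1..n+1}\<close> matter.\<close>

definition net_flow :: "nat \<Rightarrow> (nat \<Rightarrow> int) \<Rightarrow> nat \<Rightarrow> int" where
  "net_flow n c = c(n + 1 := - (\<Sum>i=1..n. c i))"

definition basis_vec :: "nat \<Rightarrow> nat \<Rightarrow> int" where
  "basis_vec i = (\<lambda>v. if v = i then 1 else 0)"


section \<open>The Kostant partition function\<close>

definition kostant_flows :: "(nat, 'e) pre_digraph \<Rightarrow> (nat \<Rightarrow> int) \<Rightarrow> ('e \<Rightarrow> nat) set" where
  "kostant_flows G c =
     {b \<in> arcs G \<rightarrow>\<^sub>E UNIV. \<forall>v\<in>verts G.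
        (\<Sum>e\<in>arcs G. int (b e) * (basis_vec (tail G e) v - basis_vec (head G e) v)) = c v}"

definition kostant_partition :: "(nat, 'e) pre_digraph \<Rightarrow> (nat \<Rightarrow> int) \<Rightarrow> nat" where
  "kostant_partition G c = card (kostant_flows G c)"


section \<open>Gravity diagrams\<close>

text \<open>The coefficient of \<open>\<alpha>\<^sub>i = e\<^sub>i - e\<^sub>i\<^sub>+\<^sub>1\<close> in a vector with coordinate sum zero.\<close>

definition root_coeff :: "(nat \<Rightarrow> int) \<Rightarrow> nat \<Rightarrow> int" where
  "root_coeff c i = (\<Sum>k=1..i. c k)"

text \<open>The dot \<open>(i, r)\<close> lies in column \<open>i\<close>.\<close>

definition dots :: "nat \<Rightarrow> (nat \<Rightarrow> int) \<Rightarrow> (nat \<times> int) set" where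
  "dots n c = (SIGMA i:{1..n}. {1..root_coeff c i})"

text \<open>
  A line-dot diagram is a pair of a partition of the dots into lines and an assignment of arcs to
  the lines. As \<^const>\<open>fst\<close> gives the column of a dot, the \<^const>\<open>bij_betw\<close> condition says that
  a line has exactly one dot in each column from the tail to just before the head of its arc, and
  no dots elsewhere. If some coefficient is negative, there are no diagrams, although the array
  \<^const>\<open>dots\<close> is still defined.
\<close>

type_synonym 'e line_dot = "(nat \<times> int) set set \<times> ((nat \<times> int) set \<Rightarrow> 'e)"

definition line_dot_diagrams ::
    "(nat, 'e) pre_digraph \<Rightarrow> nat \<Rightarrow> (nat \<Rightarrow> int) \<Rightarrow> 'e line_dot set" where
  "line_dot_diagrams G n c =
     {(P, a). (\<forall>i\<in>{1..n}. 0 \<le> root_coeff c i) \<and>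
        partition_on (dots n c) P \<and> a \<in> P \<rightarrow>\<^sub>E arcs G \<and>
        (\<forall>L\<in>P. bij_betw fst L {tail G (a L)..<head G (a L)})}"

definition num_lines :: "'e line_dot \<Rightarrow> 'e \<Rightarrow> nat" where
  "num_lines D e = card {L \<in> fst D. snd D L = e}"

definition same_vector_partition ::
    "(nat, 'e) pre_digraph \<Rightarrow> nat \<Rightarrow> (nat \<Rightarrow> int) \<Rightarrow> 'e line_dot rel" where
  "same_vector_partition G n c =
     {(D, D'). D \<in> line_dot_diagrams G n c \<and> D' \<in> line_dot_diagrams G n c \<and>
        (\<forall>e\<in>arcs G. num_lines D e = num_lines D' e)}"

definition gravity_diagrams ::
    "(nat, 'e) pre_digraph \<Rightarrow> nat \<Rightarrow> (nat \<Rightarrow> int) \<Rightarrow> 'e line_dot set set" where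
  "gravity_diagrams G n c = line_dot_diagrams G n c // same_vector_partition G n c"

lemma equiv_same_vector_partition:
  "equiv (line_dot_diagrams G n c) (same_vector_partition G n c)"
  unfolding same_vector_partition_def
  by (rule equivI) (auto simp: refl_on_def sym_def trans_def)


section \<open>Finiteness\<close>

text \<open>Both sets that are counted are finite, so \<^const>\<open>card\<close> is their true cardinality.\<close>

lemma finite_dots: "finite (dots n c)"
  unfolding dots_def by (rule finite_SigmaI) auto

context flow_graph
begin

lemma finite_line_dot_diagrams: "finite (line_dot_diagrams G n c)"
proof -
  have "finite (P \<rightarrow>\<^sub>E arcs G)" if "P \<in> Pow (Pow (dots n c))" for P
    using that finite_subset[of P "Pow (dots n c)"] finite_dots[of n c] by (intro finite_PiE) auto
  then have "finite (SIGMA P:Pow (Pow (dots n c)). P \<rightarrow>\<^sub>E arcs G)"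
    using finite_dots by (intro finite_SigmaI) auto
  then show ?thesis
    by (rule rev_finite_subset) (auto simp: line_dot_diagrams_def partition_on_def)
qed

lemma finite_gravity_diagrams: "finite (gravity_diagrams G n c)"
  unfolding gravity_diagrams_def
  by (rule finite_quotient)
     (auto simp: finite_line_dot_diagrams same_vector_partition_def)

lemma kostant_flow_prefix_sum:
  assumes b: "b \<in> kostant_flows G c" and k: "k \<le> n"
  shows "(\<Sum>e | e \<in> arcs G \<and> tail G e \<le> k \<and> k < head G e. int (b e)) = root_coeff c k"
proof -
  have tail_ge: "1 \<le> tail G e" if "e \<in> arcs G" for e
    using tail_in_verts[OF that] verts_eq by simp
  have ind: "sum (basis_vec i) {Suc 0..k} = (if i \<le> k then 1 else 0)" if "1 \<le> i" for i
    using that by (simp add: basis_vec_def sum.delta)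
  have "root_coeff c k = (\<Sum>v=1..k. \<Sum>e\<in>arcs G.
      int (b e) * (basis_vec (tail G e) v - basis_vec (head G e) v))"
    unfolding root_coeff_def using b k verts_eq
    by (intro sum.cong) (auto simp: kostant_flows_def)
  also have "\<dots> = (\<Sum>e\<in>arcs G.
      int (b e) * ((\<Sum>v=1..k. basis_vec (tail G e) v) - (\<Sum>v=1..k. basis_vec (head G e) v)))"
    by (subst sum.swap) (simp flip: sum_distrib_left sum_subtractf)
  also have "\<dots> = (\<Sum>e\<in>arcs G. if tail G e \<le> k \<and> k < head G e then int (b e) else 0)"
  proof (intro sum.cong refl)
    fix e assume "e \<in> arcs G"
    then have "1 \<le> tail G e" "1 \<le> head G e" "tail G e < head G e"
      using tail_ge[of e] tail_less_head[of e] by auto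
    then show "int (b e) *
        ((\<Sum>v=1..k. basis_vec (tail G e) v) - (\<Sum>v=1..k. basis_vec (head G e) v)) =
        (if tail G e \<le> k \<and> k < head G e then int (b e) else 0)"
      by (auto simp: ind)
  qed
  also have "\<dots> = (\<Sum>e | e \<in> arcs G \<and> tail G e \<le> k \<and> k < head G e. int (b e))"
    by (simp add: sum.inter_filter)
  finally show ?thesis by simp
qed

lemma finite_kostant_flows: "finite (kostant_flows G c)"
proof -
  have "b e \<le> nat (root_coeff c (tail G e))" if b: "b \<in> kostant_flows G c" and e: "e \<in> arcs G"
    for b e
  proof -
    have "tail G e \<le> n"
      using tail_less_head[OF e] head_in_verts[OF e] verts_eq by simp
    from kostant_flow_prefix_sum[OF b this]
    have "root_coeff c (tail G e) =
        (\<Sum>e' | e' \<in> arcs G \<and> tail G e' \<le> tail G e \<and> tail G e < head G e'. int (b e'))" by simp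
    also have "\<dots> \<ge> int (b e)"
      using e tail_less_head[OF e] by (intro member_le_sum) auto
    finally show ?thesis by simp
  qed
  then have "kostant_flows G c \<subseteq> (\<Pi>\<^sub>E e\<in>arcs G. {..nat (root_coeff c (tail G e))})"
    by (auto simp: PiE_def Pi_def kostant_flows_def)
  then show ?thesis
    by (rule finite_subset) (intro finite_PiE; simp)
qed

end

end

theory Submission
  imports Defs
begin

text \<open>
  A tuple \<open>b\<close> has net flow \<open>c'\<close> iff for every \<open>k\<close> the arcs from \<open>{1..k}\<close> to \<open>{k+1..n+1}\<close> carry \<open>d\<^sub>k\<close>
  units in total, and in a line-dot diagram the \<open>d\<^sub>k\<close> dots of column \<open>k\<close> count the lines passing
  through it. So counting the lines assigned to each arc maps diagrams to flows, and the fibres of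
  this map are the equivalence classes. It is onto: given a flow, there are as many units of flow
  passing column \<open>k\<close> as dots in it, and arbitrary bijections between the two, one per column, string
  the dots together to lines.
\<close>

text \<open>On \<open>A\<close> the classes are the nonempty fibres of \<open>f\<close>, and such a
  fibre determines its value. The inclusion in \<open>A \<times> A\<close> keeps each class inside
  \<open>A\<close>.\<close>

lemma card_quotient_eq_card_image:
  assumes "\<And>x y. x \<in> A \<Longrightarrow> y \<in> A \<Longrightarrow> (x, y) \<in> r \<longleftrightarrow> f x = f y"
    and "r \<subseteq> A \<times> A"
  shows "card (A // r) = card (f ` A)"
proof -
  have cls: "r `` {x} = {y \<in> A. f y = f x}" if "x \<in> A" for x
    using that assms by auto
  have "A // r = (\<lambda>z. {y \<in> A. f y = z}) ` f ` A"
    by (auto simp: quotient_def cls image_iff)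
  moreover have "inj_on (\<lambda>z. {y \<in> A. f y = z}) (f ` A)"
    by (rule inj_onI) blast
  ultimately show ?thesis
    by (simp add: card_image)
qed

text \<open>Group the right-hand sum by the value of \<open>a\<close>. This turns sums over arcs
  weighted by line counts into sums over lines.\<close>

lemma sum_fibres:
  assumes "finite P" "finite A" "a ` P \<subseteq> A"
  shows "(\<Sum>e\<in>A. int (card {L \<in> P. a L = e}) * f e) = (\<Sum>L\<in>P. f (a L))"
proof -
  have "(\<Sum>L\<in>P. f (a L)) = (\<Sum>e\<in>A. \<Sum>L | L \<in> P \<and> a L = e. f (a L))"
    using assms by (simp only: sum.group)
  also have "\<dots> = (\<Sum>e\<in>A. int (card {L \<in> P. a L = e}) * f e)"
    by (intro sum.cong refl) simp
  finally show ?thesis ..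
qed

lemma bij_betw_fst_card_column:
  assumes "bij_betw fst L I"
  shows "card {d \<in> L. fst d = i} = (if i \<in> I then 1 else 0)"
proof (cases "i \<in> I")
  case True
  then obtain d where d: "d \<in> L" "fst d = i"
    using assms by (auto simp: bij_betw_def)
  then have "{d \<in> L. fst d = i} = {d}"
    using assms by (auto simp: bij_betw_def inj_on_def)
  then show ?thesis
    using True by simp
next
  case False
  then have "{d \<in> L. fst d = i} = {}"
    using bij_betwE[OF assms] by auto
  then show ?thesis
    by (simp only: False card.empty if_False)
qed

text \<open>Double counting: each line has one dot in column \<open>i\<close> if it passes through
  that column, and none otherwise.\<close>

lemma card_column_partition:
  assumes "finite D" "partition_on D P" "\<And>L. L \<in> P \<Longrightarrow> bij_betw fst L (I L)"
  shows "card {d \<in> D. fst d = i} = card {L \<in> P. i \<in> I L}"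
proof -
  have P: "finite P" "\<Union>P = D" "\<And>L. L \<in> P \<Longrightarrow> finite L"
    using assms finite_elements partition_onD1
    by (blast, blast, metis Union_upper finite_subset)
  have "{d \<in> D. fst d = i} = (\<Union>L\<in>P. {d \<in> L. fst d = i})"
    using P(2) by auto
  also have "card \<dots> = (\<Sum>L\<in>P. card {d \<in> L. fst d = i})"
    using P partition_onD2[OF assms(2)]
    by (intro card_UN_disjoint) (auto simp: disjoint_def)
  also have "\<dots> = (\<Sum>L\<in>P. if i \<in> I L then 1 else 0)"
    by (intro sum.cong refl bij_betw_fst_card_column assms)
  also have "\<dots> = card {L \<in> P. i \<in> I L}"
    using P(1) by (simp flip: sum.inter_filter)
  finally show ?thesis .
qed

lemma dots_column:
  assumes "i \<in> {1..n}"
  shows "{d \<in> dots n c. fst d = i} = {i} \<times> {1..root_coeff c i}"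
  using assms by (auto simp: dots_def)

lemma root_coeff_0 [simp]: "root_coeff c 0 = 0"
  by (simp add: root_coeff_def)

lemma root_coeff_Suc: "root_coeff c (Suc k) = root_coeff c k + c (Suc k)"
  by (simp add: root_coeff_def)

lemma root_coeff_net_flow_Suc_n: "root_coeff (net_flow n c) (Suc n) = 0"
  by (simp add: root_coeff_def net_flow_def)

text \<open>The restriction gives the extensional functions that \<open>kostant_flows\<close>
  consists of, so that two diagrams have equal flows as soon as their line counts agree on the
  arcs.\<close>

definition flow_of_diagram :: "(nat, 'e) pre_digraph \<Rightarrow> 'e line_dot \<Rightarrow> 'e \<Rightarrow> nat" where
  "flow_of_diagram G D = restrict (num_lines D) (arcs G)"

text \<open>Here \<open>x = (e, j)\<close> stands for unit number \<open>j\<close> of the flow on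
  the arc \<open>e\<close>, and \<open>g i x\<close> is the row of the dot that this unit occupies
  in column \<open>i\<close>.\<close>

definition flow_line ::
    "(nat, 'e) pre_digraph \<Rightarrow> (nat \<Rightarrow> 'e \<times> nat \<Rightarrow> int) \<Rightarrow> 'e \<times> nat \<Rightarrow> (nat \<times> int) set" where
  "flow_line G g x = (\<lambda>i. (i, g i x)) ` {tail G (fst x)..<head G (fst x)}"

lemma mem_flow_line:
  "(i, r) \<in> flow_line G g x \<longleftrightarrow> i \<in> {tail G (fst x)..<head G (fst x)} \<and> r = g i x"
  by (auto simp: flow_line_def)

lemma bij_betw_fst_flow_line:
  "bij_betw fst (flow_line G g x) {tail G (fst x)..<head G (fst x)}"
  by (force simp: flow_line_def bij_betw_def inj_on_def)

context flow_graph
begin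

lemma arc_bounds:
  assumes "e \<in> arcs G"
  shows "1 \<le> tail G e" "tail G e < head G e" "head G e \<le> Suc n"
  using tail_in_verts[OF assms] head_in_verts[OF assms] tail_less_head[OF assms] verts_eq by auto

text \<open>Converse of \<open>kostant_flow_prefix_sum\<close>: the equation at vertex
  \<open>v\<close> is the difference of the cut equations for \<open>v\<close> and
  \<open>v - 1\<close>. The cuts \<open>0\<close> and \<open>Suc n\<close> are crossed by no arc, so
  at the last vertex this needs \<open>total\<close>.\<close>

lemma kostant_flowsI:
  assumes b: "b \<in> arcs G \<rightarrow>\<^sub>E UNIV"
    and total: "root_coeff c (Suc n) = 0"
    and prefix: "\<And>k. k \<in> {1..n} \<Longrightarrow>
      (\<Sum>e\<in>arcs G. int (b e) * (if k \<in> {tail G e..<head G e} then 1 else 0)) = root_coeff c k"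
  shows "b \<in> kostant_flows G c"
proof -
  let ?S = "\<lambda>k. \<Sum>e\<in>arcs G. int (b e) * (if k \<in> {tail G e..<head G e} then 1 else 0)"
  have S: "?S k = root_coeff c k" if k: "k \<le> Suc n" for k
  proof -
    consider "k = 0" | "k = Suc n" | "k \<in> {1..n}"
      using k by fastforce
    then show ?thesis
    proof cases
      case 1
      then show ?thesis
        using arc_bounds by (intro trans[OF sum.neutral]) fastforce+
    next
      case 2
      then show ?thesis
        using arc_bounds total by (intro trans[OF sum.neutral]) fastforce+
    qed (rule prefix)
  qed
  have "(\<Sum>e\<in>arcs G. int (b e) * (basis_vec (tail G e) v - basis_vec (head G e) v)) = c v"
    if "v \<in> verts G" for v
  proof -
    from that obtain k where k: "v = Suc k" "k \<le> n"
      using verts_eq by (cases v) auto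
    \<comment> \<open>From \<open>k\<close> to \<open>v = Suc k\<close> the indicator of
      \<open>{tail G e..<head G e}\<close> rises by 1 if \<open>v\<close> is the tail and drops by 1
      if \<open>v\<close> is the head.\<close>
    have "(\<Sum>e\<in>arcs G. int (b e) * (basis_vec (tail G e) v - basis_vec (head G e) v))
        = ?S v - ?S k"
      unfolding sum_subtractf[symmetric]
    proof (intro sum.cong refl)
      fix e assume "e \<in> arcs G"
      note arc_bounds[OF this]
      then show "int (b e) * (basis_vec (tail G e) v - basis_vec (head G e) v)
          = int (b e) * (if v \<in> {tail G e..<head G e} then 1 else 0)
            - int (b e) * (if k \<in> {tail G e..<head G e} then 1 else 0)"
        using k by (auto simp: basis_vec_def)
    qed
    then show ?thesis
      using k S[of v] S[of k] by (simp add: root_coeff_Suc)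
  qed
  with b show ?thesis
    by (simp add: kostant_flows_def)
qed

text \<open>The flow across cut \<open>k\<close> and the dots of column \<open>k\<close> both count
  the lines through that column.\<close>

lemma flow_of_diagram_in_kostant_flows:
  assumes D: "D \<in> line_dot_diagrams G n c" and total: "root_coeff c (Suc n) = 0"
  shows "flow_of_diagram G D \<in> kostant_flows G c"
proof -
  obtain P a where Pa: "D = (P, a)"
    by fastforce
  let ?I = "\<lambda>L. {tail G (a L)..<head G (a L)}"
  have P: "partition_on (dots n c) P" and a: "a \<in> P \<rightarrow>\<^sub>E arcs G"
    and I: "\<And>L. L \<in> P \<Longrightarrow> bij_betw fst L (?I L)"
    and nonneg: "\<And>i. i \<in> {1..n} \<Longrightarrow> 0 \<le> root_coeff c i"
    using D by (auto simp: line_dot_diagrams_def Pa)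
  have finP: "finite P"
    using P finite_dots finite_elements by blast
  show ?thesis
  proof (rule kostant_flowsI)
    fix k assume k: "k \<in> {1..n}"
    have "(\<Sum>e\<in>arcs G. int (flow_of_diagram G D e) * (if k \<in> {tail G e..<head G e} then 1 else 0))
        = (\<Sum>e\<in>arcs G. int (card {L \<in> P. a L = e}) * (if k \<in> {tail G e..<head G e} then 1 else 0))"
      by (intro sum.cong refl) (simp add: flow_of_diagram_def num_lines_def Pa)
    also have "\<dots> = (\<Sum>L\<in>P. if k \<in> ?I L then 1 else 0)"
      using a finP by (intro sum_fibres) auto
    also have "\<dots> = int (card {L \<in> P. k \<in> ?I L})"
      using finP by (simp flip: sum.inter_filter)
    also have "\<dots> = int (card {d \<in> dots n c. fst d = k})"
      using card_column_partition[OF finite_dots P I] by simp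
    also have "\<dots> = root_coeff c k"
      using nonneg[OF k] by (simp add: dots_column[OF k] card_cartesian_product)
    finally show "(\<Sum>e\<in>arcs G. int (flow_of_diagram G D e) *
        (if k \<in> {tail G e..<head G e} then 1 else 0)) = root_coeff c k" .
  qed (auto simp: flow_of_diagram_def total)
qed

lemma ex_diagram_of_flow:
  assumes b: "b \<in> kostant_flows G c"
  shows "\<exists>D\<in>line_dot_diagrams G n c. flow_of_diagram G D = b"
proof -
  \<comment> \<open>\<open>X\<close> is the set of single units of flow, and \<open>S i\<close>
    consists of those passing column \<open>i\<close>.\<close>
  define X where "X = (SIGMA e:arcs G. {..<b e})"
  define S where "S i = {x \<in> X. i \<in> {tail G (fst x)..<head G (fst x)}}" for i
  have finX: "finite X"
    by (auto simp: X_def)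
  have card_S: "int (card (S i)) = root_coeff c i" if "i \<le> n" for i
  proof -
    have "S i = (SIGMA e:{e \<in> arcs G. tail G e \<le> i \<and> i < head G e}. {..<b e})"
      by (auto simp: S_def X_def)
    then have "int (card (S i)) = (\<Sum>e | e \<in> arcs G \<and> tail G e \<le> i \<and> i < head G e. int (b e))"
      by simp
    then show ?thesis
      using kostant_flow_prefix_sum[OF b that] by simp
  qed
  have "\<exists>h. bij_betw h (S i) {1..root_coeff c i}" if "i \<le> n" for i
    using card_S[OF that] finX by (intro finite_same_card_bij) (auto simp: S_def)
  then obtain g where g: "\<And>i. i \<le> n \<Longrightarrow> bij_betw (g i) (S i) {1..root_coeff c i}"
    by metis
  let ?L = "flow_line G g"
  have X_arc: "fst x \<in> arcs G" if "x \<in> X" for x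
    using that by (auto simp: X_def)
  \<comment> \<open>A dot fixes its column \<open>i\<close>, and injectivity of \<open>g i\<close>
    then recovers the unit.\<close>
  have unique: "x = y" if "x \<in> X" "y \<in> X" "d \<in> ?L x" "d \<in> ?L y" for x y d
  proof -
    obtain i r where d: "d = (i, r)"
      by fastforce
    have "x \<in> S i" "y \<in> S i" "g i x = g i y" "i \<le> n"
      using that arc_bounds(3)[OF X_arc[OF that(1)]] by (auto simp: d mem_flow_line S_def)
    then show ?thesis
      using g by (meson bij_betw_imp_inj_on inj_onD)
  qed
  have nonempty: "?L x \<noteq> {}" if "x \<in> X" for x
    using arc_bounds(2)[OF X_arc[OF that]] by (auto simp: flow_line_def)
  \<comment> \<open>Lines of distinct units are disjoint and nonempty, hence distinct.\<close>
  have inj: "inj_on ?L X"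
    by (rule inj_onI) (metis nonempty unique ex_in_conv)
  define a where "a = (\<lambda>L\<in>?L ` X. fst (inv_into X ?L L))"
  have a_line: "a (?L x) = fst x" if "x \<in> X" for x
    using that inj by (simp add: a_def)
  have "\<Union> (?L ` X) = dots n c"
  proof (rule set_eqI, clarify)
    fix i r
    have "(i, r) \<in> \<Union> (?L ` X) \<longleftrightarrow> (\<exists>x\<in>S i. r = g i x)"
      by (simp add: mem_flow_line S_def Bex_def conj_assoc)
    \<comment> \<open>Arcs start at 1 or later and end at \<open>Suc n\<close> or earlier, so units
      pass only the columns 1 to \<open>n\<close>. There the surjectivity of \<open>g i\<close>
      yields all dots.\<close>
    also have "\<dots> \<longleftrightarrow> i \<in> {1..n} \<and> r \<in> g i ` S i"
      using arc_bounds X_arc by (fastforce simp: S_def)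
    also have "\<dots> \<longleftrightarrow> (i, r) \<in> dots n c"
      by (simp add: dots_def bij_betw_imp_surj_on[OF g] cong: conj_cong)
    finally show "(i, r) \<in> \<Union> (?L ` X) \<longleftrightarrow> (i, r) \<in> dots n c" .
  qed
  moreover have "disjoint (?L ` X)"
    by (auto simp: disjoint_def dest: unique)
  moreover have "{} \<notin> ?L ` X"
    by (metis nonempty imageE)
  ultimately have "partition_on (dots n c) (?L ` X)"
    by (simp add: partition_on_def)
  \<comment> \<open>By \<open>card_S\<close> the coefficient is a cardinality.\<close>
  moreover have "0 \<le> root_coeff c i" if "i \<in> {1..n}" for i
    using card_S[of i] that by auto
  moreover have "a \<in> ?L ` X \<rightarrow>\<^sub>E arcs G"
    using a_line X_arc by (auto simp: a_def)
  ultimately have "(?L ` X, a) \<in> line_dot_diagrams G n c"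
    by (auto simp: line_dot_diagrams_def a_line bij_betw_fst_flow_line)
  moreover have "flow_of_diagram G (?L ` X, a) = b"
  proof
    fix e
    have "num_lines (?L ` X, a) e = b e" if "e \<in> arcs G"
    proof -
      have "{L \<in> ?L ` X. a L = e} = ?L ` {x \<in> X. fst x = e}"
        using a_line by auto
      then have "num_lines (?L ` X, a) e = card {x \<in> X. fst x = e}"
        using inj_on_subset[OF inj] by (simp add: num_lines_def card_image)
      also have "{x \<in> X. fst x = e} = {e} \<times> {..<b e}"
        using that by (auto simp: X_def)
      finally show ?thesis
        by (simp add: card_cartesian_product)
    qed
    \<comment> \<open>Off the arcs both sides are \<open>undefined\<close>.\<close>
    then show "flow_of_diagram G (?L ` X, a) e = b e"
      using b by (auto simp: flow_of_diagram_def kostant_flows_def)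
  qed
  ultimately show ?thesis
    by blast
qed

lemma flow_of_diagram_image:
  assumes "root_coeff c (Suc n) = 0"
  shows "flow_of_diagram G ` line_dot_diagrams G n c = kostant_flows G c"
  using flow_of_diagram_in_kostant_flows[OF _ assms] ex_diagram_of_flow by blast

lemma same_vector_partition_iff_flow_eq:
  assumes "D \<in> line_dot_diagrams G n c" "D' \<in> line_dot_diagrams G n c"
  shows "(D, D') \<in> same_vector_partition G n c \<longleftrightarrow> flow_of_diagram G D = flow_of_diagram G D'"
  using assms
  by (auto simp: same_vector_partition_def flow_of_diagram_def restrict_def fun_eq_iff)

end

theorem theorem3p1:
  fixes G :: "(nat, 'e) pre_digraph" and n :: nat and c :: "nat \<Rightarrow> int"
  assumes "flow_graph G n"
  shows "kostant_partition G (net_flow n c) = card (gravity_diagrams G n (net_flow n c))"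
proof -
  interpret flow_graph G n
    by fact
  let ?D = "line_dot_diagrams G n (net_flow n c)"
  have "card (gravity_diagrams G n (net_flow n c)) = card (flow_of_diagram G ` ?D)"
    unfolding gravity_diagrams_def
    by (intro card_quotient_eq_card_image same_vector_partition_iff_flow_eq)
       (auto simp: same_vector_partition_def)
  then show ?thesis
    by (simp add: kostant_partition_def flow_of_diagram_image root_coeff_net_flow_Suc_n)
qed

end
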